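(* Let $\mathcal{C}\subseteq\mathbb{Z}_2^\alpha\times\mathbb{Z}_4^\beta$ be a $\mathbb{Z}_2\mathbb{Z}_4$-additive code such that $\Phi(\mathcal{C})$ is $\mathbb{Z}_2$-linear. Then $\theta(\mathcal{C})\subseteq\mathbb{Z}_2^\alpha\times\mathbb{Z}_2[u]^\beta$ is a $\mathbb{Z}_2\mathbb{Z}_2[u]$-additive code.
   Context: A $\mathbb{Z}_2\mathbb{Z}_4$-additive code with parameters $(\alpha,\beta)$ is an additive subgroup of $\mathbb{Z}_2^\alpha\times\mathbb{Z}_4^\beta$. The Gray map $\phi:\mathbb{Z}_4\to\mathbb{Z}_2^2$ is $\phi(0)=(0,0)$, $\phi(1)=(0,1)$, $\phi(2)=(1,1)$, $\phi(3)=(1,0)$, extended coordinatewise, and $\Phi(x\mid x')=(x\mid\phi(x'))\in\mathbb{Z}_2^{\alpha+2\beta}$. Let $\mathbb{Z}_2[u]=\{0,1,u,1+u\}$ be the ring with $u^2=0$, and $\pi:\mathbb{Z}_2[u]\to\mathbb{Z}_2$ with $\pi(0)=\pi(u)=0$, $\pi(1)=\pi(1+u)=1$. $\mathbb{Z}_2^\alpha\times\mathbb{Z}_2[u]^\beta$ is a $\mathbb{Z}_2[u]$-module with componentwise addition and scalar multiplication $\lambda(x_1,\dots,x_\alpha\mid x'_1,\dots,x'_\beta)=(\pi(\lambda)x_1,\dots,\pi(\lambda)x_\alpha\mid\lambda x'_1,\dots,\lambda x'_\beta)$; a $\mathbb{Z}_2\mathbb{Z}_2[u]$-additive code is a $\mathbb{Z}_2[u]$-submodule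 of it. The map $\theta:\mathbb{Z}_2^\alpha\times\mathbb{Z}_4^\beta\to\mathbb{Z}_2^\alpha\times\mathbb{Z}_2[u]^\beta$ is $\theta(x_1,\dots,x_\alpha\mid y_1,\dots,y_\beta)=(x_1,\dots,x_\alpha\mid\vartheta(y_1),\dots,\vartheta(y_\beta))$ with $\vartheta(0)=0$, $\vartheta(1)=1$, $\vartheta(2)=u$, $\vartheta(3)=1+u$. *)

theory Defs
  imports
    "HOL-Library.Z2"
    "HOL-Library.Numeral_Type"
    "Jordan_Normal_Form.VS_Connect"
begin

text \<open>
  The ring \<open>\<int>\<^sub>2\<close> is the type \<^typ>\<open>bit\<close>, and \<open>\<int>\<^sub>4\<close> is the type \<^typ>\<open>4\<close> of integers modulo 4.
  The ring \<open>\<int>\<^sub>2[u]\<close> with \<open>u\<^sup>2 = 0\<close> is represented by pairs: \<open>Z2u a b\<close> stands for \<open>a + b u\<close>.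
\<close>

datatype z2u = Z2u (re2: bit) (im2: bit)

lemma all_z2u:
  "(\<forall>x. P x) \<longleftrightarrow> P (Z2u 0 0) \<and> P (Z2u 0 1) \<and> P (Z2u 1 0) \<and> P (Z2u 1 1)"
  by (metis bit.exhaust z2u.exhaust)

instantiation z2u :: comm_ring_1
begin

definition zero_z2u :: z2u where "0 = Z2u 0 0"
definition one_z2u :: z2u where "1 = Z2u 1 0"
definition plus_z2u :: "z2u \<Rightarrow> z2u \<Rightarrow> z2u" where
  "x + y = Z2u (re2 x + re2 y) (im2 x + im2 y)"
definition uminus_z2u :: "z2u \<Rightarrow> z2u" where
  "- x = Z2u (- re2 x) (- im2 x)"
definition minus_z2u :: "z2u \<Rightarrow> z2u \<Rightarrow> z2u" where
  "x - y = Z2u (re2 x - re2 y) (im2 x - im2 y)"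
definition times_z2u :: "z2u \<Rightarrow> z2u \<Rightarrow> z2u" where
  "x * y = Z2u (re2 x * re2 y) (re2 x * im2 y + im2 x * re2 y)"

instance
proof -
  note ops = zero_z2u_def one_z2u_def plus_z2u_def uminus_z2u_def minus_z2u_def times_z2u_def
  have "\<forall>a b c :: z2u. a * b * c = a * (b * c) \<and> a + b + c = a + (b + c) \<and>
      (a + b) * c = a * c + b * c"
    by (simp add: all_z2u ops)
  moreover have "\<forall>a b :: z2u. a * b = b * a \<and> a + b = b + a \<and> a - b = a + - b"
    by (simp add: all_z2u ops)
  moreover have "\<forall>a :: z2u. 1 * a = a \<and> 0 + a = a \<and> - a + a = 0"
    by (simp add: all_z2u ops)
  moreover have "(0 :: z2u) \<noteq> 1"
    by (simp add: ops)
  ultimately show "OFCLASS(z2u, comm_ring_1_class)"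
    by intro_classes blast+
qed

end

definition u_z2u :: z2u where "u_z2u = Z2u 0 1"

lemma u_square: "u_z2u * u_z2u = 0"
  by (simp add: u_z2u_def times_z2u_def zero_z2u_def)

lemma UNIV_z2u: "(UNIV :: z2u set) = {0, 1, u_z2u, 1 + u_z2u}"
proof -
  have "x \<in> {0, 1, u_z2u, 1 + u_z2u}" for x :: z2u
    by (cases x; cases "re2 x"; cases "im2 x")
      (auto simp: zero_z2u_def one_z2u_def u_z2u_def plus_z2u_def)
  then show ?thesis by auto
qed

lemma distinct_z2u: "distinct [0, 1, u_z2u, 1 + u_z2u]"
  by (auto simp: zero_z2u_def one_z2u_def u_z2u_def plus_z2u_def)

definition pi_z2u :: "z2u \<Rightarrow> bit" where
  "pi_z2u l = (if l = 0 \<or> l = u_z2u then 0 else 1)"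

lemma pi_z2u_eq_re2: "pi_z2u l = re2 l"
  by (cases l; cases "re2 l"; cases "im2 l")
    (auto simp: pi_z2u_def zero_z2u_def u_z2u_def)

lemma pi_z2u_hom:
  "pi_z2u 1 = 1" "pi_z2u (k + l) = pi_z2u k + pi_z2u l" "pi_z2u (k * l) = pi_z2u k * pi_z2u l"
  unfolding pi_z2u_eq_re2 one_z2u_def plus_z2u_def times_z2u_def by simp_all

lemma UNIV_Z4: "(UNIV :: 4 set) = {0, 1, 2, 3}"
proof -
  have "card {0, 1, 2, 3 :: 4} = CARD(4)" by simp
  then show ?thesis by (metis card_subset_eq finite subset_UNIV)
qed

definition Z2Z4_group :: "nat \<Rightarrow> nat \<Rightarrow> (bit vec \<times> 4 vec) monoid" where
  "Z2Z4_group \<alpha> \<beta> = monoid_vec TYPE(bit) \<alpha> \<times>\<times> monoid_vec TYPE(4) \<beta>"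

definition Z2Z4_additive_code :: "nat \<Rightarrow> nat \<Rightarrow> (bit vec \<times> 4 vec) set \<Rightarrow> bool" where
  "Z2Z4_additive_code \<alpha> \<beta> C \<longleftrightarrow> subgroup C (Z2Z4_group \<alpha> \<beta>)"

definition gray :: "4 \<Rightarrow> bit \<times> bit" where
  "gray y = (if y = 0 then (0, 0) else if y = 1 then (0, 1)
    else if y = 2 then (1, 1) else (1, 0))"

text \<open>
  The coordinatewise extension concatenates the pairs: coordinates \<open>2 j\<close> and \<open>2 j + 1\<close> of the
  image are the two components of \<open>gray (y $ j)\<close>.
\<close>

definition gray_vec :: "4 vec \<Rightarrow> bit vec" where
  "gray_vec y = vec (2 * dim_vec y)
    (\<lambda>i. (if even i then fst else snd) (gray (y $ (i div 2))))"

definition Gray :: "bit vec \<times> 4 vec \<Rightarrow> bit vec" where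
  "Gray = (\<lambda>(x, y). x @\<^sub>v gray_vec y)"

definition Z2_linear :: "nat \<Rightarrow> bit vec set \<Rightarrow> bool" where
  "Z2_linear n D \<longleftrightarrow> subspace class_ring D (module_vec TYPE(bit) n)"

text \<open>
  The ring multiplication and unit of the record play no role in a module and are left
  unspecified, as in \<^const>\<open>module_vec\<close>.
\<close>

definition Z2Z2u_module :: "nat \<Rightarrow> nat \<Rightarrow> (z2u, bit vec \<times> z2u vec) module" where
  "Z2Z2u_module \<alpha> \<beta> =
    \<lparr>carrier = carrier_vec \<alpha> \<times> carrier_vec \<beta>,
     mult = undefined,
     one = undefined,
     zero = (0\<^sub>v \<alpha>, 0\<^sub>v \<beta>),
     add = (\<lambda>(x, x') (y, y'). (x + y, x' + y')),
     smult = (\<lambda>l (x, x'). (pi_z2u l \<cdot>\<^sub>v x, l \<cdot>\<^sub>v x'))\<rparr>"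

lemma module_Z2Z2u_module: "module class_ring (Z2Z2u_module \<alpha> \<beta>)"
proof (rule moduleI)
  show "cring (class_ring :: z2u ring)"
    by (rule class_cring.is_cring)
  show "abelian_group (Z2Z2u_module \<alpha> \<beta>)"
  proof (rule abelian_groupI)
    fix v assume "v \<in> carrier (Z2Z2u_module \<alpha> \<beta>)"
    then show "\<exists>w\<in>carrier (Z2Z2u_module \<alpha> \<beta>). w \<oplus>\<^bsub>Z2Z2u_module \<alpha> \<beta>\<^esub> v = \<zero>\<^bsub>Z2Z2u_module \<alpha> \<beta>\<^esub>"
      by (intro bexI[of _ "(- fst v, - snd v)"]) (auto simp: Z2Z2u_module_def)
  qed (auto simp: Z2Z2u_module_def comm_add_vec)
qed (auto simp: Z2Z2u_module_def pi_z2u_hom add_smult_distrib_vec smult_add_distrib_vec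
    simp flip: smult_smult_assoc)

definition Z2Z2u_additive_code :: "nat \<Rightarrow> nat \<Rightarrow> (bit vec \<times> z2u vec) set \<Rightarrow> bool" where
  "Z2Z2u_additive_code \<alpha> \<beta> D \<longleftrightarrow> submodule class_ring D (Z2Z2u_module \<alpha> \<beta>)"

definition vartheta :: "4 \<Rightarrow> z2u" where
  "vartheta y = (if y = 0 then 0 else if y = 1 then 1 else if y = 2 then u_z2u else 1 + u_z2u)"

definition theta :: "bit vec \<times> 4 vec \<Rightarrow> bit vec \<times> z2u vec" where
  "theta = (\<lambda>(x, y). (x, map_vec vartheta y))"

end

theory Submission
  imports Defs
begin

text \<open>
  The map \<open>\<vartheta>\<close> is the Gray map followed by the \<open>\<int>\<^sub>2\<close>-linear change of coordinates
  \<open>(a, b) \<mapsto> (a + b) + a u\<close>. Hence \<open>\<theta>\<close> differs from \<open>\<Phi>\<close> by a linear isomorphism, and additive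
  closure of \<open>\<theta>(C)\<close> is linearity of \<open>\<Phi>(C)\<close>. Multiplication by \<open>u\<close> corresponds to doubling in
  \<open>C\<close>, as \<open>u \<vartheta>(y) = \<vartheta>(2 y)\<close>.
\<close>

lemma four_cases:
  fixes y :: 4
  obtains "y = 0" | "y = 1" | "y = 2" | "y = 3"
  using UNIV_Z4 by blast

lemma vartheta_gray: "vartheta y = Z2u (fst (gray y) + snd (gray y)) (fst (gray y))"
  by (cases y rule: four_cases)
    (simp_all add: vartheta_def gray_def zero_z2u_def one_z2u_def u_z2u_def plus_z2u_def)

text \<open>By \<open>vartheta_gray\<close>, \<open>vartheta\<close> is linear in the two Gray bits.
  Here \<open>z\<close> need not be \<open>x + y\<close> in Z4: for \<open>x = y = 1\<close> the
  hypotheses give \<open>z = 0\<close>, not 2.\<close>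

lemma vartheta_add:
  assumes "fst (gray z) = fst (gray x) + fst (gray y)" "snd (gray z) = snd (gray x) + snd (gray y)"
  shows "vartheta z = vartheta x + vartheta y"
  by (simp only: assms vartheta_gray plus_z2u_def z2u.sel ac_simps)

text \<open>Both sides depend only on the parity of \<open>y\<close>: they vanish for even
  \<open>y\<close> and equal \<open>u_z2u\<close> for odd \<open>y\<close>.\<close>

lemma vartheta_double: "vartheta (2 * y) = u_z2u * vartheta y"
  by (cases y rule: four_cases)
    (simp_all add: vartheta_def zero_z2u_def one_z2u_def u_z2u_def plus_z2u_def times_z2u_def)

lemma gray_vec_dim [simp]: "dim_vec (gray_vec y) = 2 * dim_vec y"
  by (simp add: gray_vec_def)

lemma gray_vec_index:
  assumes "j < dim_vec y"
  shows "gray_vec y $ (2 * j) = fst (gray (y $ j))" "gray_vec y $ (2 * j + 1) = snd (gray (y $ j))"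
  using assms by (simp_all add: gray_vec_def)

lemma map_vartheta_add:
  assumes "gray_vec y = gray_vec y1 + gray_vec y2" "dim_vec y1 = dim_vec y2"
  shows "map_vec vartheta y = map_vec vartheta y1 + map_vec vartheta y2"
proof
  \<comment> \<open>A vector sum takes its dimension from the right summand, so comparing dimensions
    in the Gray equation and halving gives this.\<close>
  have dim: "dim_vec y = dim_vec y2"
    using arg_cong[OF assms(1), of dim_vec] by simp
  then show "dim_vec (map_vec vartheta y) = dim_vec (map_vec vartheta y1 + map_vec vartheta y2)"
    by simp
  fix j assume "j < dim_vec (map_vec vartheta y1 + map_vec vartheta y2)"
  then have j: "j < dim_vec y" "j < dim_vec y1" "j < dim_vec y2"
    using dim assms(2) by simp_all
  have "fst (gray (y $ j)) = fst (gray (y1 $ j)) + fst (gray (y2 $ j))"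
    using arg_cong[OF assms(1), of "\<lambda>v. v $ (2 * j)"] j by (simp add: gray_vec_index)
  moreover have "snd (gray (y $ j)) = snd (gray (y1 $ j)) + snd (gray (y2 $ j))"
    using arg_cong[OF assms(1), of "\<lambda>v. v $ (2 * j + 1)"] j
      gray_vec_index(2)[OF j(1)] gray_vec_index(2)[OF j(2)] gray_vec_index(2)[OF j(3)]
    by simp
  ultimately show "map_vec vartheta y $ j = (map_vec vartheta y1 + map_vec vartheta y2) $ j"
    using j vartheta_add[of "y $ j" "y1 $ j" "y2 $ j"] by simp
qed

lemma theta_add:
  assumes "Gray (x, y) = Gray (x1, y1) + Gray (x2, y2)"
    and "dim_vec x = dim_vec x1" "dim_vec x1 = dim_vec x2"
    and "dim_vec y1 = dim_vec y2"
  shows "x = x1 + x2" "map_vec vartheta y = map_vec vartheta y1 + map_vec vartheta y2"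
proof -
  have car: "x1 \<in> carrier_vec (dim_vec x)" "x2 \<in> carrier_vec (dim_vec x)"
    "gray_vec y1 \<in> carrier_vec (2 * dim_vec y1)" "gray_vec y2 \<in> carrier_vec (2 * dim_vec y1)"
    using assms(2-4) by (auto intro: carrier_vecI)
  have eq: "x @\<^sub>v gray_vec y = (x1 + x2) @\<^sub>v (gray_vec y1 + gray_vec y2)"
    using assms(1) append_vec_add[OF car] by (simp add: Gray_def)
  have "x \<in> carrier_vec (dim_vec x)" "x1 + x2 \<in> carrier_vec (dim_vec x)"
    using car(1,2) by simp_all
  \<comment> \<open>Both prefixes have the same length, so the concatenation splits uniquely into
    its binary and Gray parts.\<close>
  with eq have "x = x1 + x2 \<and> gray_vec y = gray_vec y1 + gray_vec y2"
    using append_vec_eq by blast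
  then show "x = x1 + x2" "map_vec vartheta y = map_vec vartheta y1 + map_vec vartheta y2"
    using map_vartheta_add assms(4) by blast+
qed

text \<open>The binary part vanishes because \<open>bit\<close> has characteristic two; this matches
  the action of u there, since \<pi>(u) = 0.\<close>

lemma theta_double: "theta (x + x, y + y) = (0\<^sub>v (dim_vec x), u_z2u \<cdot>\<^sub>v map_vec vartheta y)"
  unfolding theta_def prod.case prod.inject
  by (intro conjI eq_vecI) (simp_all add: vartheta_double)

theorem theorem3:
  fixes \<alpha> \<beta> :: nat and C :: "(bit vec \<times> 4 vec) set"
  assumes "Z2Z4_additive_code \<alpha> \<beta> C"
    and "Z2_linear (\<alpha> + 2 * \<beta>) (Gray ` C)"
  shows "Z2Z2u_additive_code \<alpha> \<beta> (theta ` C)"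
proof -
  let ?M = "Z2Z2u_module \<alpha> \<beta>"
  interpret C: subgroup C "Z2Z4_group \<alpha> \<beta>"
    using assms(1) by (simp add: Z2Z4_additive_code_def)
  have carrier: "dim_vec (fst c) = \<alpha>" "dim_vec (snd c) = \<beta>" if "c \<in> C" for c
    using C.subset that by (auto simp: Z2Z4_group_def monoid_vec_def DirProd_def)
  have zero: "(0\<^sub>v \<alpha>, 0\<^sub>v \<beta>) \<in> C"
    using C.one_closed by (simp add: Z2Z4_group_def monoid_vec_def)
  have double: "(x + x, y + y) \<in> C" if "(x, y) \<in> C" for x y
    using C.m_closed[OF that that] by (simp add: Z2Z4_group_def monoid_vec_def)
  \<comment> \<open>The linearity of \<Phi>(C) enters the proof here.\<close>
  have Gray_add: "Gray c + Gray d \<in> Gray ` C" if "c \<in> C" "d \<in> C" for c d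
    using assms(2) that
    unfolding Z2_linear_def subspace_def submodule_def by (auto simp: module_vec_def)
  have add: "v \<oplus>\<^bsub>?M\<^esub> w \<in> theta ` C" if "v \<in> theta ` C" "w \<in> theta ` C" for v w
  proof -
    from that obtain x1 y1 x2 y2 where 1: "(x1, y1) \<in> C" "v = theta (x1, y1)"
      and 2: "(x2, y2) \<in> C" "w = theta (x2, y2)"
      by auto
    \<comment> \<open>This codeword comes from linearity of the Gray image and not from addition in
      \<open>C\<close>; \<open>y\<close> may differ from \<open>y1 + y2\<close>.\<close>
    from Gray_add[OF 1(1) 2(1)] obtain x y
      where e: "(x, y) \<in> C" "Gray (x, y) = Gray (x1, y1) + Gray (x2, y2)"
      by (metis imageE surj_pair)
    have "x = x1 + x2" "map_vec vartheta y = map_vec vartheta y1 + map_vec vartheta y2"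
      using theta_add[OF e(2)] carrier[OF 1(1)] carrier[OF 2(1)] carrier[OF e(1)] by simp_all
    then have "v \<oplus>\<^bsub>?M\<^esub> w = theta (x, y)"
      using 1 2 by (simp add: theta_def Z2Z2u_module_def)
    with e(1) show ?thesis by blast
  qed
  have sub: "theta ` C \<subseteq> carrier ?M"
  proof
    fix v assume "v \<in> theta ` C"
    then obtain x y where c: "(x, y) \<in> C" "v = theta (x, y)" by auto
    have "x \<in> carrier_vec \<alpha>" "map_vec vartheta y \<in> carrier_vec \<beta>"
      using carrier[OF c(1)] by (auto intro: carrier_vecI)
    then show "v \<in> carrier ?M"
      unfolding c(2) theta_def Z2Z2u_module_def by simp
  qed
  have zero': "\<zero>\<^bsub>?M\<^esub> \<in> theta ` C"
  proof -
    have "\<zero>\<^bsub>?M\<^esub> = theta (0\<^sub>v \<alpha>, 0\<^sub>v \<beta>)"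
      by (auto simp: theta_def Z2Z2u_module_def vartheta_def)
    with zero show ?thesis by blast
  qed
  have u: "u_z2u \<odot>\<^bsub>?M\<^esub> v \<in> theta ` C" if "v \<in> theta ` C" for v
  proof -
    from that obtain x y where c: "(x, y) \<in> C" "v = theta (x, y)" by auto
    \<comment> \<open>The witness is the double of the codeword, which lies in \<open>C\<close>
      because \<open>C\<close> is a subgroup.\<close>
    have "u_z2u \<odot>\<^bsub>?M\<^esub> v = theta (x + x, y + y)"
      unfolding theta_double using c(2)
      by (auto simp: theta_def Z2Z2u_module_def pi_z2u_def)
    with double[OF c(1)] show ?thesis by blast
  qed
  interpret M: Module.module "class_ring :: z2u ring" ?M by (rule module_Z2Z2u_module)
  have smult: "l \<odot>\<^bsub>?M\<^esub> v \<in> theta ` C" if v: "v \<in> theta ` C" for l v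
  proof -
    have vM: "v \<in> carrier ?M" using v sub by blast
    \<comment> \<open>Since 1 and u span the scalars additively, closure under addition and under u
      suffices; 1 + u is handled by distributivity.\<close>
    consider "l = 0" | "l = 1" | "l = u_z2u" | "l = 1 + u_z2u" using UNIV_z2u by blast
    then show ?thesis
    proof cases
      case 1 then show ?thesis using M.smult_l_null[OF vM] zero' by (simp add: class_ring_simps)
    next
      case 2 then show ?thesis using M.smult_one[OF vM] v by (simp add: class_ring_simps)
    next
      case 3 then show ?thesis using u v by simp
    next
      case 4
      then have "l \<odot>\<^bsub>?M\<^esub> v = v \<oplus>\<^bsub>?M\<^esub> u_z2u \<odot>\<^bsub>?M\<^esub> v"
        using M.smult_l_distr[of 1 u_z2u, OF _ _ vM] M.smult_one[OF vM]
        by (simp add: class_ring_simps)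
      then show ?thesis using add u v by simp
    qed
  qed
  show ?thesis
    unfolding Z2Z2u_additive_code_def
    by (intro LinearCombinations.submodule.intro module_Z2Z2u_module sub add zero' smult)
qed

end
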